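(* For every sequence $l=\{a_i;\ i=1,2,3,\dots\}$ of real numbers, the complete statistical fuzzy limit $L_{\mathrm{stat}}(l)=[\mathbb{R},\mu]$ of $l$, with membership function $a\mapsto\mu(a=\mathrm{stat}\text{-}\lim l)$, is a normal fuzzy set if and only if $l$ statistically converges.
   Context: $\mathbb{N}=\{1,2,3,\dots\}$. For $K\subseteq\mathbb{N}$ put $K_n=\{k\in K: k\le n\}$; the asymptotic density of $K$ is $d(K)=\lim_{n\to\infty}\frac1n|K_n|$ whenever the limit exists. A sequence $l$ of real numbers statistically converges if there is $a\in\mathbb{R}$ such that for every $\varepsilon>0$ the set $\{i\in\mathbb{N}: |a_i-a|\ge\varepsilon\}$ has density $0$. For a real $r\ge0$, $a=\mathrm{stat}\text{-}r\text{-}\lim l$ means that for every $\varepsilon>0$ the set $\{i\in\mathbb{N}: |a_i-a|\ge r+\varepsilon\}$ has density $0$. The upper statistical defect of statistical convergence of $l$ to $a\in\mathbb{R}$ is $\delta(a=\mathrm{stat}\text{-}\lim l)=\inf\{r\ge0: a=\mathrm{stat}\text{-}r\text{-}\lim l\}$ (equal to $+\infty$ if there is no such $r$). The upper statistical measure of statistical convergence of $l$ to $a$ is $\mu(a=\mathrm{stat}\text{-}\lim l)=\frac{1}{1+\delta(a=\mathrm{stat}\text{-}\lim l)}$ (equal to $0$ if the defect is $+\infty$). The complete statistical fuzzy limit $L_{\mathrm{stat}}(l)$ is the fuzzy set on $\mathbb{R}$ with membership function $a\mapsto\mu(a=\mathrm{stat}\text{-}\lim l)$. A fuzzy set $[A,\mu]$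 is normal if $\sup_{x\in A}\mu(x)=1$. *)

theory Defs
  imports Complex_Main "HOL-Library.Extended_Real"
begin

text \<open>
  The natural numbers start at 1 here: a real sequence is a function of type
  \<^typ>\<open>nat \<Rightarrow> real\<close> of which only the terms with index at least 1 are used, so the value
  at 0 is irrelevant.
\<close>

definition has_density :: "nat set \<Rightarrow> real \<Rightarrow> bool" where
  "has_density K d \<longleftrightarrow> (\<lambda>n. real (card {k \<in> K. 1 \<le> k \<and> k \<le> n}) / real n) \<longlonglongrightarrow> d"

definition stat_lim :: "real \<Rightarrow> (nat \<Rightarrow> real) \<Rightarrow> bool" where
  "stat_lim a l \<longleftrightarrow> (\<forall>\<epsilon>>0. has_density {i. 1 \<le> i \<and> \<bar>l i - a\<bar> \<ge> \<epsilon>} 0)"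

definition stat_convergent :: "(nat \<Rightarrow> real) \<Rightarrow> bool" where
  "stat_convergent l \<longleftrightarrow> (\<exists>a. stat_lim a l)"

definition stat_r_lim :: "real \<Rightarrow> real \<Rightarrow> (nat \<Rightarrow> real) \<Rightarrow> bool" where
  "stat_r_lim r a l \<longleftrightarrow> (\<forall>\<epsilon>>0. has_density {i. 1 \<le> i \<and> \<bar>l i - a\<bar> \<ge> r + \<epsilon>} 0)"

text \<open>The infimum is taken in the extended reals, where the infimum of the empty set is \<open>\<infinity>\<close>.\<close>

definition stat_defect :: "real \<Rightarrow> (nat \<Rightarrow> real) \<Rightarrow> ereal" where
  "stat_defect a l = Inf {ereal r | r. 0 \<le> r \<and> stat_r_lim r a l}"

definition stat_measure :: "real \<Rightarrow> (nat \<Rightarrow> real) \<Rightarrow> real" where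
  "stat_measure a l =
     (if stat_defect a l = \<infinity> then 0 else 1 / (1 + real_of_ereal (stat_defect a l)))"

text \<open>A fuzzy set \<open>[A, \<mu>]\<close> is a carrier together with a membership function into \<open>[0, 1]\<close>.\<close>

type_synonym 'a fuzzy = "'a set \<times> ('a \<Rightarrow> real)"

definition fuzzy_set :: "'a fuzzy \<Rightarrow> bool" where
  "fuzzy_set F \<longleftrightarrow> (\<forall>x \<in> fst F. 0 \<le> snd F x \<and> snd F x \<le> 1)"

text \<open>
  The supremum is taken in the extended reals, so that it has its usual meaning
  also when the carrier is empty.
\<close>

definition normal_fuzzy_set :: "'a fuzzy \<Rightarrow> bool" where
  "normal_fuzzy_set F \<longleftrightarrow> fuzzy_set F \<and> (SUP x \<in> fst F. ereal (snd F x)) = 1"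

definition complete_stat_fuzzy_limit :: "(nat \<Rightarrow> real) \<Rightarrow> real fuzzy" where
  "complete_stat_fuzzy_limit l = (UNIV, \<lambda>a. stat_measure a l)"

end

theory Submission
  imports Defs
begin

text \<open>
  Everything rests on the density-zero ideal of sets of indices.  The measure at a point \<open>a\<close> is
  large exactly when the defect at \<open>a\<close> is small, and the defect at \<open>a\<close> is below \<open>\<delta>\<close> only if
  almost all terms (all but a set of indices of density zero) lie within \<open>\<delta>\<close> of \<open>a\<close>.  So
  normality says that for every \<open>\<delta> > 0\<close> almost all terms lie in some interval of radius \<open>\<delta>\<close>,
  which is a statistical Cauchy condition: the centre may depend on \<open>\<delta>\<close>, and the supremum in the
  definition of normality need not visibly be attained.

  The remaining point is the completeness argument \<open>stat_convergent_if_almost_all_near\<close>.  Two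
  intervals that each contain almost all terms have a term in common, because the union of two sets
  of density zero cannot be all of the positive integers.  Hence the centres for radii
  tending to zero form a Cauchy sequence of reals, and its limit is the statistical limit.
  Conversely, at a statistical limit the defect is zero and the membership grade is
  exactly one.
\<close>

section \<open>Sets of density zero\<close>

lemma has_density_zero_subset:
  assumes "has_density B 0" "A \<subseteq> B"
  shows "has_density A 0"
  unfolding has_density_def
proof (rule tendsto_sandwich[OF _ _ tendsto_const assms(1)[unfolded has_density_def]])
  show "\<forall>\<^sub>F n in sequentially. real (card {k \<in> A. 1 \<le> k \<and> k \<le> n}) / real n
          \<le> real (card {k \<in> B. 1 \<le> k \<and> k \<le> n}) / real n"
  proof (intro always_eventually allI divide_right_mono of_nat_mono card_mono)
    fix n :: nat
    show "finite {k \<in> B. 1 \<le> k \<and> k \<le> n}"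
      by (rule finite_subset[of _ "{..n}"]) auto
    show "{k \<in> A. 1 \<le> k \<and> k \<le> n} \<subseteq> {k \<in> B. 1 \<le> k \<and> k \<le> n}"
      using assms(2) by auto
  qed auto
qed auto

lemma has_density_zero_Un:
  assumes "has_density A 0" "has_density B 0"
  shows "has_density (A \<union> B) 0"
proof -
  let ?c = "\<lambda>K n. real (card {k \<in> K. 1 \<le> k \<and> k \<le> n}) / real n"
  have "(\<lambda>n. ?c A n + ?c B n) \<longlonglongrightarrow> 0"
    using tendsto_add[OF assms[unfolded has_density_def]] by simp
  moreover have "?c (A \<union> B) n \<le> ?c A n + ?c B n" for n
  proof -
    have "{k \<in> A \<union> B. 1 \<le> k \<and> k \<le> n}
        = {k \<in> A. 1 \<le> k \<and> k \<le> n} \<union> {k \<in> B. 1 \<le> k \<and> k \<le> n}"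
      by auto
    then have "real (card {k \<in> A \<union> B. 1 \<le> k \<and> k \<le> n})
        \<le> real (card {k \<in> A. 1 \<le> k \<and> k \<le> n}) + real (card {k \<in> B. 1 \<le> k \<and> k \<le> n})"
      by (simp only: of_nat_le_iff card_Un_le flip: of_nat_add)
    then show ?thesis
      by (simp add: divide_right_mono flip: add_divide_distrib)
  qed
  ultimately show ?thesis
    unfolding has_density_def
    by (intro tendsto_sandwich[of "\<lambda>_. 0" "?c (A \<union> B)" _ "\<lambda>n. ?c A n + ?c B n"])
       auto
qed

lemma has_density_zero_imp_missing:
  assumes "has_density K 0"
  obtains i where "1 \<le> i" "i \<notin> K"
proof (rule ccontr)
  assume "\<not> thesis"
  then have "i \<in> K" if "1 \<le> i" for i
    using \<open>\<And>i. 1 \<le> i \<Longrightarrow> i \<notin> K \<Longrightarrow> thesis\<close> that by blast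
  then have "{k \<in> K. 1 \<le> k \<and> k \<le> n} = {1..n}" for n
    by auto
  then have "(\<lambda>n. real n / real n) \<longlonglongrightarrow> 0"
    using assms unfolding has_density_def by simp
  moreover have "(\<lambda>n. real n / real n) \<longlonglongrightarrow> 1"
    by (rule tendsto_eventually) (use eventually_gt_at_top[of 0] in eventually_elim, simp)
  ultimately show False
    using LIMSEQ_unique by fastforce
qed

section \<open>Statistical completeness of the reals\<close>

lemma almost_all_near_centres_close:
  fixes l :: "nat \<Rightarrow> real"
  assumes "has_density {i. 1 \<le> i \<and> \<bar>l i - a\<bar> \<ge> r} 0"
    and "has_density {i. 1 \<le> i \<and> \<bar>l i - b\<bar> \<ge> s} 0"
  shows "\<bar>a - b\<bar> < r + s"
proof -
  obtain i where "1 \<le> i"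
    "i \<notin> {i. 1 \<le> i \<and> \<bar>l i - a\<bar> \<ge> r} \<union> {i. 1 \<le> i \<and> \<bar>l i - b\<bar> \<ge> s}"
    using has_density_zero_imp_missing[OF has_density_zero_Un[OF assms]] .
  then have "\<bar>l i - a\<bar> < r" "\<bar>l i - b\<bar> < s"
    by auto
  then show ?thesis
    by linarith
qed

text \<open>
  The approximate centres for shrinking radii are forced to be mutually close by the preceding lemma,
  so completeness of the reals supplies a single centre that works for all radii.
\<close>

lemma stat_convergent_if_almost_all_near:
  fixes l :: "nat \<Rightarrow> real"
  assumes "\<And>\<delta>. \<delta> > 0 \<Longrightarrow> \<exists>a. has_density {i. 1 \<le> i \<and> \<bar>l i - a\<bar> \<ge> \<delta>} 0"
  shows "stat_convergent l"
proof -
  define \<delta> where "\<delta> n = inverse (real (Suc n))" for n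
  have \<delta>_pos: "\<delta> n > 0" for n
    by (simp add: \<delta>_def)
  have \<delta>_lim: "\<delta> \<longlonglongrightarrow> 0"
    unfolding \<delta>_def by (rule LIMSEQ_inverse_real_of_nat)
  have "\<exists>c. \<forall>n. has_density {i. 1 \<le> i \<and> \<bar>l i - c n\<bar> \<ge> \<delta> n} 0"
    by (rule choice) (use assms[OF \<delta>_pos] in blast)
  then obtain c where c: "has_density {i. 1 \<le> i \<and> \<bar>l i - c n\<bar> \<ge> \<delta> n} 0" for n
    by blast
  have "Cauchy c"
  proof (rule metric_CauchyI)
    fix e :: real
    assume "e > 0"
    then obtain M where M: "\<And>n. n \<ge> M \<Longrightarrow> \<delta> n < e / 2"
      using order_tendstoD(2)[OF \<delta>_lim, of "e / 2"] by (auto simp: eventually_sequentially)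
    have "dist (c m) (c n) < e" if "m \<ge> M" "n \<ge> M" for m n
      using almost_all_near_centres_close[OF c c, of m n] M[OF that(1)] M[OF that(2)]
      by (simp add: dist_real_def)
    then show "\<exists>M. \<forall>m\<ge>M. \<forall>n\<ge>M. dist (c m) (c n) < e"
      by blast
  qed
  then obtain a where a: "c \<longlonglongrightarrow> a"
    using Cauchy_convergent convergent_def by blast
  have "has_density {i. 1 \<le> i \<and> \<bar>l i - a\<bar> \<ge> \<epsilon>} 0" if "\<epsilon> > 0" for \<epsilon>
  proof -
    have "\<forall>\<^sub>F n in sequentially. \<delta> n < \<epsilon> / 2 \<and> dist (c n) a < \<epsilon> / 2"
      using that by (intro eventually_conj order_tendstoD(2)[OF \<delta>_lim] tendstoD[OF a]) auto
    then obtain n where "\<delta> n < \<epsilon> / 2" "\<bar>c n - a\<bar> < \<epsilon> / 2"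
      by (auto simp: eventually_sequentially dist_real_def)
    then have "\<delta> n \<le> \<bar>x - c n\<bar>" if "\<epsilon> \<le> \<bar>x - a\<bar>" for x
      using that by linarith
    then show ?thesis
      by (intro has_density_zero_subset[OF c[of n]]) auto
  qed
  then show ?thesis
    unfolding stat_convergent_def stat_lim_def by blast
qed

section \<open>Defect and measure\<close>

lemma stat_defect_nonneg: "0 \<le> stat_defect a l"
  unfolding stat_defect_def by (rule Inf_greatest) auto

lemma stat_measure_nonneg: "0 \<le> stat_measure a l"
  using stat_defect_nonneg[of a l] by (simp add: stat_measure_def real_of_ereal_pos)

lemma stat_measure_le_one: "stat_measure a l \<le> 1"
  using stat_defect_nonneg[of a l]
  by (cases "stat_defect a l") (auto simp: stat_measure_def)

lemma stat_measure_eq_one_if_stat_lim: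
  assumes "stat_lim a l"
  shows "stat_measure a l = 1"
proof -
  have "stat_r_lim 0 a l"
    using assms by (simp add: stat_lim_def stat_r_lim_def)
  then have "stat_defect a l \<le> ereal 0"
    unfolding stat_defect_def by (intro Inf_lower) auto
  then have "stat_defect a l = 0"
    using stat_defect_nonneg[of a l] by (simp add: zero_ereal_def)
  then show ?thesis
    by (simp add: stat_measure_def)
qed

text \<open>
  The bound \<open>1 / (1 + \<delta>)\<close> on the measure is the bound \<open>\<delta>\<close> on the defect.  The latter is an infimum
  and need not be attained, which is harmless because the inequality is strict: some admissible \<open>r\<close>
  lies below \<open>\<delta>\<close>, and the slack \<open>\<delta> - r\<close> serves as the \<open>\<epsilon>\<close> in the definition of the limit
  up to \<open>r\<close>.
\<close>

lemma almost_all_near_if_stat_measure_gt: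
  assumes "\<delta> > 0" "stat_measure a l > 1 / (1 + \<delta>)"
  shows "has_density {i. 1 \<le> i \<and> \<bar>l i - a\<bar> \<ge> \<delta>} 0"
proof -
  have "stat_defect a l \<noteq> \<infinity>"
    using assms by (auto simp: stat_measure_def)
  then obtain d where d: "stat_defect a l = ereal d" "d \<ge> 0"
    using stat_defect_nonneg[of a l] by (cases "stat_defect a l") auto
  then have "1 / (1 + \<delta>) < 1 / (1 + d)"
    using assms(2) by (simp add: stat_measure_def)
  then have "d < \<delta>"
    using d(2) assms(1) by (simp add: field_simps)
  then have "Inf {ereal r | r. 0 \<le> r \<and> stat_r_lim r a l} < ereal \<delta>"
    using d(1) by (simp add: stat_defect_def)
  then obtain r where r: "stat_r_lim r a l" "r < \<delta>"
    by (auto simp: Inf_less_iff)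
  then have "has_density {i. 1 \<le> i \<and> \<bar>l i - a\<bar> \<ge> r + (\<delta> - r)} 0"
    by (simp only: stat_r_lim_def diff_gt_0_iff_gt)
  then show ?thesis
    by simp
qed

section \<open>Normality and statistical convergence\<close>

theorem theorem3p5:
  fixes l :: "nat \<Rightarrow> real"
  shows "normal_fuzzy_set (complete_stat_fuzzy_limit l) \<longleftrightarrow> stat_convergent l"
proof
  assume "normal_fuzzy_set (complete_stat_fuzzy_limit l)"
  then have sup: "(SUP a. ereal (stat_measure a l)) = 1"
    by (simp add: normal_fuzzy_set_def complete_stat_fuzzy_limit_def)
  show "stat_convergent l"
  proof (rule stat_convergent_if_almost_all_near)
    fix \<delta> :: real
    assume "\<delta> > 0"
    then have "ereal (1 / (1 + \<delta>)) < (SUP a. ereal (stat_measure a l))"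
      by (simp add: sup one_ereal_def)
    then obtain a where "1 / (1 + \<delta>) < stat_measure a l"
      by (auto simp: less_SUP_iff)
    then show "\<exists>a. has_density {i. 1 \<le> i \<and> \<bar>l i - a\<bar> \<ge> \<delta>} 0"
      using almost_all_near_if_stat_measure_gt[OF \<open>\<delta> > 0\<close>] by blast
  qed
next
  assume "stat_convergent l"
  then obtain a where "stat_measure a l = 1"
    unfolding stat_convergent_def using stat_measure_eq_one_if_stat_lim by blast
  then have "1 \<le> (SUP a. ereal (stat_measure a l))"
    by (intro SUP_upper2[of a]) (auto simp: one_ereal_def)
  moreover have "(SUP a. ereal (stat_measure a l)) \<le> 1"
    by (rule SUP_least) (simp add: one_ereal_def stat_measure_le_one)
  ultimately show "normal_fuzzy_set (complete_stat_fuzzy_limit l)"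
    by (simp add: normal_fuzzy_set_def complete_stat_fuzzy_limit_def fuzzy_set_def
        stat_measure_nonneg stat_measure_le_one)
qed

end
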